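(* Let $v\ge 2$ and $1\le t\le s$ be integers. If there is a $(t,s,v)$-AONT, then there is an $(s,s-t,t,v)$-resilient function.
   Context: A $(t,s,v)$-all-or-nothing transform (AONT) over an alphabet $X$ with $|X|=v$ is a bijection $\phi: X^s\to X^s$ such that for every $I\subseteq\{1,\dots,s\}$ with $|I|=t$ and every $J\subseteq\{1,\dots,s\}$ with $|J|=t$, for every $\mathbf{a}\in X^{I}$ and every $\mathbf{b}\in X^{\{1,\dots,s\}\setminus J}$ there is exactly one $\mathbf{x}\in X^s$ with $\mathbf{x}|_I=\mathbf{a}$ and $\phi(\mathbf{x})|_{\{1,\dots,s\}\setminus J}=\mathbf{b}$ (i.e., given any $s-t$ outputs, any $t$ inputs are completely undetermined). An $(n,m,t,v)$-resilient function is a function $g: X^n\to X^m$, $|X|=v$, such that if any $t$ of the $n$ input values are fixed and the remaining $n-t$ input values are chosen independently and uniformly at random, then every output $m$-tuple occurs with probability exactly $1/v^m$. *)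

theory Defs
  imports "HOL-Probability.Probability"
begin

text \<open>
  Tuples over an alphabet \<open>X\<close> indexed by \<open>I \<subseteq> {1..s}\<close> are the extensional functions
  \<open>I \<rightarrow>\<^sub>E X\<close>, so that the restriction of a tuple to an index set is \<open>restrict\<close> and
  equality of tuples is equality of functions.
\<close>

definition is_AONT ::
  "'a set \<Rightarrow> nat \<Rightarrow> nat \<Rightarrow> nat \<Rightarrow> ((nat \<Rightarrow> 'a) \<Rightarrow> (nat \<Rightarrow> 'a)) \<Rightarrow> bool" where
  "is_AONT X t s v \<phi> \<longleftrightarrow>
     finite X \<and> card X = v \<and>
     bij_betw \<phi> ({1..s} \<rightarrow>\<^sub>E X) ({1..s} \<rightarrow>\<^sub>E X) \<and>
     (\<forall>I J. I \<subseteq> {1..s} \<and> card I = t \<and> J \<subseteq> {1..s} \<and> card J = t \<longrightarrow>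
       (\<forall>a \<in> I \<rightarrow>\<^sub>E X. \<forall>b \<in> ({1..s} - J) \<rightarrow>\<^sub>E X.
         \<exists>!x. x \<in> {1..s} \<rightarrow>\<^sub>E X \<and> restrict x I = a \<and> restrict (\<phi> x) ({1..s} - J) = b))"

text \<open>
  \<open>Pi_pmf\<close> with default \<open>undefined\<close> is the law of independent coordinates, living on the
  extensional functions; \<open>merge\<close> glues the fixed inputs \<open>a\<close> to the random inputs \<open>z\<close>.
\<close>

definition is_resilient ::
  "'a set \<Rightarrow> nat \<Rightarrow> nat \<Rightarrow> nat \<Rightarrow> nat \<Rightarrow> ((nat \<Rightarrow> 'a) \<Rightarrow> (nat \<Rightarrow> 'a)) \<Rightarrow> bool" where
  "is_resilient X n m t v g \<longleftrightarrow>
     finite X \<and> card X = v \<and>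
     g \<in> ({1..n} \<rightarrow>\<^sub>E X) \<rightarrow> ({1..m} \<rightarrow>\<^sub>E X) \<and>
     (\<forall>I. I \<subseteq> {1..n} \<and> card I = t \<longrightarrow>
       (\<forall>a \<in> I \<rightarrow>\<^sub>E X. \<forall>y \<in> {1..m} \<rightarrow>\<^sub>E X.
         measure_pmf.prob (Pi_pmf ({1..n} - I) undefined (\<lambda>_. pmf_of_set X))
           {z. g (merge I ({1..n} - I) (a, z)) = y} = 1 / real v ^ m))"

end

theory Submission
  imports Defs
begin

text \<open>
  Keep the first \<open>s - t\<close> outputs of the transform. Once \<open>t\<close> inputs are fixed, the AONT property
  says that each value of these outputs comes from exactly one assignment of the
  remaining \<open>s - t\<close> inputs, which has probability \<open>1 / v ^ (s - t)\<close>.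
\<close>

lemma pmf_Pi_pmf_of_set:
  assumes "finite K" "finite X" "X \<noteq> {}" "z \<in> K \<rightarrow>\<^sub>E X"
  shows "pmf (Pi_pmf K undefined (\<lambda>_. pmf_of_set X)) z = 1 / real (card X) ^ card K"
proof -
  \<comment> \<open>The product formula needs \<open>z\<close> to take the default value off
    \<open>K\<close>. Since the default is \<open>undefined\<close>, this is exactly the
    extensionality of \<open>z\<close>.\<close>
  have "pmf (Pi_pmf K undefined (\<lambda>_. pmf_of_set X)) z = (\<Prod>i\<in>K. pmf (pmf_of_set X) (z i))"
    using assms by (intro pmf_Pi') (auto simp: PiE_def extensional_def)
  also have "\<dots> = (\<Prod>i\<in>K. 1 / real (card X))"
    using assms by (intro prod.cong refl) (simp add: PiE_mem[OF assms(4)])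
  finally show ?thesis by (simp add: power_one_over)
qed

text \<open>Serves to discard the null part of an event: functions that are not extensional on
  \<open>K\<close> carry no mass.\<close>

lemma set_Pi_pmf_of_set:
  assumes "finite K" "finite X" "X \<noteq> {}"
  shows "set_pmf (Pi_pmf K undefined (\<lambda>_. pmf_of_set X)) = K \<rightarrow>\<^sub>E X"
  using assms by (auto simp: set_Pi_pmf PiE_dflt_def PiE_def Pi_def extensional_def)

lemma is_AONT_imp_is_resilient:
  assumes aont: "is_AONT X t s v \<phi>" and "v > 0" and "t \<le> s"
  shows "is_resilient X s (s - t) t v (\<lambda>x. restrict (\<phi> x) {1..s - t})"
  unfolding is_resilient_def
proof (intro conjI allI ballI impI)
  show fin: "finite X" and card: "card X = v"
    using aont by (auto simp: is_AONT_def)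
  \<comment> \<open>Nonemptiness makes \<open>pmf_of_set X\<close> the uniform distribution on
    \<open>X\<close>.\<close>
  have ne: "X \<noteq> {}" using card \<open>v > 0\<close> by auto
  have "bij_betw \<phi> ({1..s} \<rightarrow>\<^sub>E X) ({1..s} \<rightarrow>\<^sub>E X)"
    using aont by (simp add: is_AONT_def)
  then have "\<phi> x \<in> {1..s} \<rightarrow>\<^sub>E X" if "x \<in> {1..s} \<rightarrow>\<^sub>E X" for x
    using that by (rule bij_betw_apply)
  then show "(\<lambda>x. restrict (\<phi> x) {1..s - t}) \<in> ({1..s} \<rightarrow>\<^sub>E X) \<rightarrow> ({1..s - t} \<rightarrow>\<^sub>E X)"
    by (intro Pi_I restrict_PiE_iff[THEN iffD2] ballI) (rule PiE_mem, assumption, auto)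
  fix I a y
  assume I: "I \<subseteq> {1..s} \<and> card I = t" and a: "a \<in> I \<rightarrow>\<^sub>E X" and y: "y \<in> {1..s - t} \<rightarrow>\<^sub>E X"
  define K where "K = {1..s} - I"
  \<comment> \<open>\<open>J\<close> collects the last \<open>t\<close> output positions, the ones
    that are dropped, so that its complement is the index set of the truncated output.\<close>
  define J where "J = {s - t + 1..s}"
  have J: "J \<subseteq> {1..s}" "card J = t" "{1..s} - J = {1..s - t}"
    using \<open>t \<le> s\<close> by (auto simp: J_def)
  have b: "y \<in> ({1..s} - J) \<rightarrow>\<^sub>E X" using y by (simp only: J(3))
  have "\<forall>I J. I \<subseteq> {1..s} \<and> card I = t \<and> J \<subseteq> {1..s} \<and> card J = t \<longrightarrow>
       (\<forall>a \<in> I \<rightarrow>\<^sub>E X. \<forall>b \<in> ({1..s} - J) \<rightarrow>\<^sub>E X.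
         \<exists>!x. x \<in> {1..s} \<rightarrow>\<^sub>E X \<and> restrict x I = a \<and> restrict (\<phi> x) ({1..s} - J) = b)"
    using aont unfolding is_AONT_def by (elim conjE)
  from this[THEN spec, THEN spec, THEN mp, THEN bspec, THEN bspec, OF _ a b]
  have "\<exists>!x. x \<in> {1..s} \<rightarrow>\<^sub>E X \<and> restrict x I = a \<and> restrict (\<phi> x) {1..s - t} = y"
    unfolding J(3) using I J(1,2) by blast
  then obtain x where x: "x \<in> {1..s} \<rightarrow>\<^sub>E X" "restrict x I = a" "restrict (\<phi> x) {1..s - t} = y"
    and uniq: "\<And>x'. x' \<in> {1..s} \<rightarrow>\<^sub>E X \<Longrightarrow> restrict x' I = a \<Longrightarrow>
      restrict (\<phi> x') {1..s - t} = y \<Longrightarrow> x' = x"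
    by (elim ex1E conjE) blast
  have finK: "finite K" and cardK: "card K = s - t"
    using I finite_subset[of I "{1..s}"] by (auto simp: K_def card_Diff_subset)
  \<comment> \<open>Existence: the free part of \<open>x\<close>, glued to \<open>a\<close>, gives
    back \<open>x\<close> and hence the output \<open>y\<close>.\<close>
  have merge_x: "merge I K (a, restrict x K) = x"
    using x(1) I unfolding x(2)[symmetric]
    by (auto simp: merge_def K_def PiE_iff extensional_def fun_eq_iff)
  \<comment> \<open>Uniqueness: any \<open>z\<close> leading to \<open>y\<close> glues with
    \<open>a\<close> to a full input subject to the same constraints as \<open>x\<close>; equating
    the two and restricting to \<open>K\<close> recovers \<open>z\<close>.\<close>
  have merge_unique: "z = restrict x K"
    if z: "z \<in> K \<rightarrow>\<^sub>E X" and eq: "restrict (\<phi> (merge I K (a, z))) {1..s - t} = y" for z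
  proof -
    have "merge I K (a, z) \<in> {1..s} \<rightarrow>\<^sub>E X"
      using z a I by (auto simp: merge_def K_def PiE_iff extensional_def)
    moreover have "restrict (merge I K (a, z)) I = a"
      using a by (auto simp: merge_def PiE_iff extensional_def fun_eq_iff)
    ultimately have "merge I K (a, z) = x" using eq by (rule uniq)
    moreover have "restrict (merge I K (a, z)) K = z"
      using z by (auto simp: merge_def K_def PiE_iff extensional_def fun_eq_iff)
    ultimately show ?thesis by simp
  qed
  let ?P = "Pi_pmf K undefined (\<lambda>_. pmf_of_set X)"
  have xK: "restrict x K \<in> K \<rightarrow>\<^sub>E X" using x(1) by (auto simp: K_def)
  \<comment> \<open>The event alone may be larger than a singleton, because \<open>merge\<close>
    ignores the values of \<open>z\<close> off \<open>K\<close>. Intersecting with the support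
    leaves one point and does not change the probability.\<close>
  have "{z. restrict (\<phi> (merge I K (a, z))) {1..s - t} = y} \<inter> set_pmf ?P = {restrict x K}"
    using merge_unique merge_x xK x(3) by (auto simp: set_Pi_pmf_of_set[OF finK fin ne])
  then have "measure_pmf.prob ?P {z. restrict (\<phi> (merge I K (a, z))) {1..s - t} = y}
      = pmf ?P (restrict x K)"
    by (metis measure_Int_set_pmf measure_pmf_single)
  also have "\<dots> = 1 / real v ^ (s - t)"
    using pmf_Pi_pmf_of_set[OF finK fin ne xK] by (simp add: card cardK)
  finally show "measure_pmf.prob (Pi_pmf ({1..s} - I) undefined (\<lambda>_. pmf_of_set X))
      {z. restrict (\<phi> (merge I ({1..s} - I) (a, z))) {1..s - t} = y} = 1 / real v ^ (s - t)"
    by (simp only: K_def)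
qed

theorem theorem27:
  fixes v t s :: nat
  assumes "v \<ge> 2" and "1 \<le> t" and "t \<le> s"
    and "\<exists>(X :: 'a set) \<phi>. is_AONT X t s v \<phi>"
  shows "\<exists>(X :: 'a set) g. is_resilient X s (s - t) t v g"
proof -
  obtain X :: "'a set" and \<phi> where "is_AONT X t s v \<phi>" using assms(4) by blast
  moreover have "v > 0" using assms(1) by simp
  ultimately show ?thesis using is_AONT_imp_is_resilient assms(3) by blast
qed

end
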